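(* Let $G$ be a finite simple graph with independence number at most $2$. If the complement $\overline{G}$ is homomorphic to the Andrásfai graph $\Gamma_d$ for some $d\in\mathbb{N}$, then $G$ contains a strong immersion of $K_{\chi(G)}$.
   Context: A homomorphism from a graph $G$ to a graph $H$ is a map $h\colon V(G)\to V(H)$ with $h(u)h(v)\in E(H)$ for every $uv\in E(G)$. For $d\in\mathbb{N}$, $\Gamma_d$ has vertex set $[3d-1]$ and edge set $\{xy : y = x+i \text{ for some } i\in\{d,\dots,2d-1\}\}$, arithmetic modulo $3d-1$. An immersion of a graph $H$ in a graph $G$ is a minimal subgraph $I$ of $G$ for which there is an injection $\mathrm{i}\colon V(H)\to V(I)$ and a set of pairwise edge-disjoint paths $\{P_e : e\in E(H)\}$ in $I$ such that the end vertices of $P_{uv}$ are precisely $\mathrm{i}(u)$ and $\mathrm{i}(v)$; the image of $\mathrm{i}$ is the set of branch vertices, and the immersion is strong if no internal vertex of any path $P_e$ is a branch vertex. $\chi(G)$ is the chromatic number. *)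

theory Defs
  imports "Graph_Theory.Graph_Theory" "HOL-Number_Theory.Cong"
begin

text \<open>
  Finite simple graphs are the library's \<^locale>\<open>pair_graph\<close>s: finite, loop-free and
  with a symmetric arc relation, so that every edge \<open>uv\<close> is present as the two arcs
  \<open>(u, v)\<close> and \<open>(v, u)\<close>. Undirected edges, on which edge-disjointness depends, are
  the sets \<open>{u, v}\<close>.
\<close>

definition edges :: "'a pair_pre_digraph \<Rightarrow> 'a set set" where
  "edges G = {{u, v} | u v. (u, v) \<in> parcs G}"

definition path_edges :: "'a vwalk \<Rightarrow> 'a set set" where
  "path_edges p = {{u, v} | u v. (u, v) \<in> set (vwalk_arcs p)}"

definition graph_complement :: "'a pair_pre_digraph \<Rightarrow> 'a pair_pre_digraph" where
  "graph_complement G =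
     \<lparr>pverts = pverts G,
      parcs = {(u, v). u \<in> pverts G \<and> v \<in> pverts G \<and> u \<noteq> v \<and> (u, v) \<notin> parcs G}\<rparr>"

definition complete_graph :: "nat \<Rightarrow> nat pair_pre_digraph" where
  "complete_graph n =
     \<lparr>pverts = {..<n}, parcs = {(u, v). u \<in> {..<n} \<and> v \<in> {..<n} \<and> u \<noteq> v}\<rparr>"

lemma complete_digraph_complete_graph: "complete_digraph n (with_proj (complete_graph n))"
  unfolding complete_digraph_pair_def by (auto simp: complete_graph_def)

definition andrasfai_graph :: "nat \<Rightarrow> nat pair_pre_digraph" where
  "andrasfai_graph d =
     \<lparr>pverts = {1..3 * d - 1},
      parcs = {(x, y). x \<in> {1..3 * d - 1} \<and> y \<in> {1..3 * d - 1} \<and>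
                       (\<exists>i \<in> {d..2 * d - 1}. [y = x + i] (mod (3 * d - 1)))}\<rparr>"

text \<open>The arc relation above is already symmetric: \<open>y = x + i\<close> gives \<open>x = y + (3d - 1 - i)\<close>.\<close>

lemma pair_graph_andrasfai_graph: "pair_graph (andrasfai_graph d)"
proof -
  let ?n = "3 * d - 1"
  have sym: "\<exists>j \<in> {d..2 * d - 1}. [x = y + j] (mod ?n)"
    if "x \<in> {1..?n}" "i \<in> {d..2 * d - 1}" "[y = x + i] (mod ?n)" for x y i :: nat
  proof (rule bexI)
    have "[y + (?n - i) = x + i + (?n - i)] (mod ?n)"
      using that(3) by (rule cong_add) simp
    moreover have "x + i + (?n - i) = x + ?n"
      using that(1,2) by auto
    ultimately have "[y + (?n - i) = x] (mod ?n)"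
      by (simp only: cong_def mod_add_self2)
    then show "[x = y + (?n - i)] (mod ?n)" by (rule cong_sym)
    show "?n - i \<in> {d..2 * d - 1}" using that(1,2) by auto
  qed
  have irrefl: False if "x \<in> {1..?n}" "i \<in> {d..2 * d - 1}" "[x = x + i] (mod ?n)" for x i :: nat
  proof -
    have "[0 = i] (mod ?n)"
      using that(3) cong_add_lcancel_nat[of x 0 i ?n] by simp
    then have "?n dvd i" by (metis cong_0_iff cong_sym)
    then have "?n \<le> i" using that(1,2) by (intro dvd_imp_le) auto
    then show False using that(1,2) by auto
  qed
  have fin: "finite (parcs (andrasfai_graph d))"
    by (rule finite_subset[of _ "{1..?n} \<times> {1..?n}"]) (auto simp: andrasfai_graph_def)
  have noloop: "(x, x) \<notin> parcs (andrasfai_graph d)" for x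
    using irrefl[of x] unfolding andrasfai_graph_def by (simp only: pair_pre_digraph.simps) blast
  have symm: "(y, x) \<in> parcs (andrasfai_graph d)" if "(x, y) \<in> parcs (andrasfai_graph d)" for x y
    using that sym[of x _ y] unfolding andrasfai_graph_def
    by (simp only: pair_pre_digraph.simps) blast
  show ?thesis
  proof unfold_locales
    show "fst e \<noteq> snd e" if "e \<in> parcs (andrasfai_graph d)" for e
      using that noloop by (metis prod.collapse)
    show "symmetric (with_proj (andrasfai_graph d))"
      using symm by (auto simp: symmetric_def intro: symI)
  qed (use fin in \<open>auto simp: andrasfai_graph_def\<close>)
qed

definition graph_hom :: "('a \<Rightarrow> 'b) \<Rightarrow> 'a pair_pre_digraph \<Rightarrow> 'b pair_pre_digraph \<Rightarrow> bool" where
  "graph_hom h G H \<longleftrightarrow>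
     h ` pverts G \<subseteq> pverts H \<and> (\<forall>(u, v) \<in> parcs G. (h u, h v) \<in> parcs H)"

definition homomorphic_to :: "'a pair_pre_digraph \<Rightarrow> 'b pair_pre_digraph \<Rightarrow> bool" where
  "homomorphic_to G H \<longleftrightarrow> (\<exists>h. graph_hom h G H)"

definition independent_set :: "'a pair_pre_digraph \<Rightarrow> 'a set \<Rightarrow> bool" where
  "independent_set G S \<longleftrightarrow> S \<subseteq> pverts G \<and> (\<forall>u \<in> S. \<forall>v \<in> S. (u, v) \<notin> parcs G)"

definition independence_number :: "'a pair_pre_digraph \<Rightarrow> nat" where
  "independence_number G = Max (card ` {S. independent_set G S})"

definition proper_coloring :: "'a pair_pre_digraph \<Rightarrow> nat \<Rightarrow> ('a \<Rightarrow> nat) \<Rightarrow> bool" where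
  "proper_coloring G k c \<longleftrightarrow>
     c ` pverts G \<subseteq> {..<k} \<and> (\<forall>(u, v) \<in> parcs G. c u \<noteq> c v)"

definition chromatic_number :: "'a pair_pre_digraph \<Rightarrow> nat" where
  "chromatic_number G = (LEAST k. \<exists>c. proper_coloring G k c)"

text \<open>
  The path \<open>P e\<close> is indexed by the undirected edge \<open>e\<close> of \<open>H\<close>; a path is given by its
  nonempty list of pairwise distinct vertices, and its two ends are not ordered.
\<close>

definition immersion_paths ::
    "'b pair_pre_digraph \<Rightarrow> 'a pair_pre_digraph \<Rightarrow> ('b \<Rightarrow> 'a) \<Rightarrow> ('b set \<Rightarrow> 'a vwalk) \<Rightarrow> bool" where
  "immersion_paths H I i P \<longleftrightarrow>
     i ` pverts H \<subseteq> pverts I \<and> inj_on i (pverts H) \<and>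
     (\<forall>e \<in> edges H. vpath (P e) (with_proj I) \<and> {hd (P e), last (P e)} = i ` e) \<and>
     (\<forall>e \<in> edges H. \<forall>f \<in> edges H. e \<noteq> f \<longrightarrow> path_edges (P e) \<inter> path_edges (P f) = {})"

text \<open>
  An immersion carries its injection \<open>i\<close> and its paths \<open>P\<close> (branch vertices and strength
  refer to them), and \<open>I\<close> is minimal among the subgraphs accommodating this \<open>i\<close> and \<open>P\<close>.
  The subgraph relation of the library allows arbitrary subdigraphs, hence the additional
  requirement that subgraphs be \<^locale>\<open>pair_graph\<close>s.
\<close>

definition immersion ::
    "'b pair_pre_digraph \<Rightarrow> 'a pair_pre_digraph \<Rightarrow> 'a pair_pre_digraph \<Rightarrow>
     ('b \<Rightarrow> 'a) \<Rightarrow> ('b set \<Rightarrow> 'a vwalk) \<Rightarrow> bool" where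
  "immersion H G I i P \<longleftrightarrow>
     pair_graph I \<and> subgraph (with_proj I) (with_proj G) \<and> immersion_paths H I i P \<and>
     (\<forall>J. pair_graph J \<and> subgraph (with_proj J) (with_proj I) \<and> immersion_paths H J i P \<longrightarrow> J = I)"

definition strong_immersion ::
    "'b pair_pre_digraph \<Rightarrow> 'a pair_pre_digraph \<Rightarrow> 'a pair_pre_digraph \<Rightarrow>
     ('b \<Rightarrow> 'a) \<Rightarrow> ('b set \<Rightarrow> 'a vwalk) \<Rightarrow> bool" where
  "strong_immersion H G I i P \<longleftrightarrow>
     immersion H G I i P \<and>
     (\<forall>e \<in> edges H. set (butlast (tl (P e))) \<inter> i ` pverts H = {})"

definition contains_strong_immersion :: "'a pair_pre_digraph \<Rightarrow> 'b pair_pre_digraph \<Rightarrow> bool" where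
  "contains_strong_immersion G H \<longleftrightarrow> (\<exists>I i P. strong_immersion H G I i P)"

end

theory Submission
  imports Defs
begin

text \<open>
  By induction on the vertex set, a graph that is not \<open>k\<close>-colourable has a strong immersion of
  \<open>K\<^bsub>k+1\<^esub>\<close>. If the complement is disconnected, the immersions of the parts can be joined. If it
  is connected and the graph is critical, Gallai's lemma, applied to the complement, whose
  matchings are the colourings, shows that there are exactly \<open>2k + 1\<close> vertices.
  In this case the homomorphism arranges the vertices in a cyclic order in which every vertex
  \<open>x\<close> is adjacent to those strictly between \<open>x\<close> and some \<open>F x\<close>, and three steps
  of \<open>F\<close> pass once around the circle. If no \<open>k + 1\<close> consecutive vertices form a clique, the branch
  vertices are \<open>k + 1\<close> consecutive ones, placed immediately before a vertex maximising \<open>F x - x\<close>.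
\<close>

section \<open>Strong immersions of complete graphs\<close>

definition doubletons :: "'a set \<Rightarrow> 'a set set" where
  "doubletons B = {{u, v} | u v. u \<in> B \<and> v \<in> B \<and> u \<noteq> v}"

text \<open>Adjacency is a fixed relation and only the vertex set \<open>V\<close> varies, so that
  an induced subgraph is obtained by shrinking \<open>V\<close>. The set \<open>e\<close> holds the
  two ends of the path in no order.\<close>

definition strong_path ::
    "('a \<Rightarrow> 'a \<Rightarrow> bool) \<Rightarrow> 'a set \<Rightarrow> 'a set \<Rightarrow> 'a set \<Rightarrow> 'a list \<Rightarrow> bool" where
  "strong_path adj V B e p \<longleftrightarrow>
     p \<noteq> [] \<and> distinct p \<and> set p \<subseteq> V \<and> (\<forall>(u, v) \<in> set (vwalk_arcs p). adj u v) \<and>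
     {hd p, last p} = e \<and> set (butlast (tl p)) \<inter> B = {}"

text \<open>The branch vertices form a set \<open>B\<close> and the paths are indexed by its pairs;
  neither a numbering of \<open>B\<close> nor a subgraph is carried through the induction. Both are
  supplied once, in \<open>contains_strong_immersion_complete_graph\<close>.\<close>

definition clique_immersion :: "('a \<Rightarrow> 'a \<Rightarrow> bool) \<Rightarrow> 'a set \<Rightarrow> nat \<Rightarrow> bool" where
  "clique_immersion adj V k \<longleftrightarrow>
     (\<exists>B Q. B \<subseteq> V \<and> card B = k \<and> (\<forall>e \<in> doubletons B. strong_path adj V B e (Q e)) \<and>
        (\<forall>e \<in> doubletons B. \<forall>f \<in> doubletons B. e \<noteq> f \<longrightarrow> path_edges (Q e) \<inter> path_edges (Q f) = {}))"

text \<open>A pair has no preferred order, while the constructions name its ends in some order. The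
  relation \<open>R\<close> may therefore offer several paths for one pair, and the choice among
  them is made here.\<close>

lemma clique_immersionI:
  assumes "B \<subseteq> V" "card B = k"
    and "\<And>e. e \<in> doubletons B \<Longrightarrow> \<exists>p. R e p"
    and "\<And>e p. e \<in> doubletons B \<Longrightarrow> R e p \<Longrightarrow> strong_path adj V B e p"
    and "\<And>e f p q. e \<in> doubletons B \<Longrightarrow> f \<in> doubletons B \<Longrightarrow> e \<noteq> f \<Longrightarrow> R e p \<Longrightarrow> R f q \<Longrightarrow>
           path_edges p \<inter> path_edges q = {}"
  shows "clique_immersion adj V k"
proof -
  obtain Q where "\<forall>e \<in> doubletons B. R e (Q e)"
    using assms(3) by metis
  then show ?thesis
    unfolding clique_immersion_def using assms(1,2,4,5) by (intro exI[of _ B] exI[of _ Q]) blast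
qed

lemma clique_immersionE:
  assumes "clique_immersion adj V k"
  obtains B Q where "B \<subseteq> V" "card B = k"
    and "\<And>e. e \<in> doubletons B \<Longrightarrow> strong_path adj V B e (Q e)"
    and "\<And>e f. e \<in> doubletons B \<Longrightarrow> f \<in> doubletons B \<Longrightarrow> e \<noteq> f \<Longrightarrow>
           path_edges (Q e) \<inter> path_edges (Q f) = {}"
  using assms unfolding clique_immersion_def by (elim exE conjE) (rule that, assumption, assumption, erule (1) bspec, metis)

lemma path_edges_2: "path_edges [a, b] = {{a, b}}"
  by (auto simp: path_edges_def)

lemma path_edges_4: "path_edges [a, b, c, d] = {{a, b}, {b, c}, {c, d}}"
  by (auto simp: path_edges_def)

lemma strong_path_edge:
  assumes "adj u v" "u \<noteq> v" "u \<in> V" "v \<in> V"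
  shows "strong_path adj V B {u, v} [u, v]"
  using assms by (auto simp: strong_path_def)

lemma clique_immersion_clique:
  assumes "B \<subseteq> V" "card B = k" "\<And>u v. u \<in> B \<Longrightarrow> v \<in> B \<Longrightarrow> u \<noteq> v \<Longrightarrow> adj u v"
  shows "clique_immersion adj V k"
proof (rule clique_immersionI[where R = "\<lambda>e p. \<exists>u \<in> B. \<exists>v \<in> B. u \<noteq> v \<and> e = {u, v} \<and> p = [u, v]"])
  fix e p
  assume R: "\<exists>u \<in> B. \<exists>v \<in> B. u \<noteq> v \<and> e = {u, v} \<and> p = [u, v]"
  then show "strong_path adj V B e p"
    using assms strong_path_edge[of adj] by blast
  fix f q assume "\<exists>u \<in> B. \<exists>v \<in> B. u \<noteq> v \<and> f = {u, v} \<and> q = [u, v]" and "e \<noteq> f"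
  with R have "path_edges p = {e}" "path_edges q = {f}" by (auto simp: path_edges_2)
  with \<open>e \<noteq> f\<close> show "path_edges p \<inter> path_edges q = {}" by simp
next
  fix e assume "e \<in> doubletons B"
  then show "\<exists>p. \<exists>u \<in> B. \<exists>v \<in> B. u \<noteq> v \<and> e = {u, v} \<and> p = [u, v]"
    unfolding doubletons_def by blast
qed fact+

text \<open>Forgetting branch vertices keeps the remaining paths strong, because their interiors
  avoid the whole of the old set \<open>B\<close>.\<close>

lemma clique_immersion_mono:
  assumes "clique_immersion adj V k" "k' \<le> k" "V \<subseteq> V'"
  shows "clique_immersion adj V' k'"
proof -
  obtain B Q where B: "B \<subseteq> V" "card B = k"
    and Q: "\<And>e. e \<in> doubletons B \<Longrightarrow> strong_path adj V B e (Q e)"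
    and disj: "\<And>e f. e \<in> doubletons B \<Longrightarrow> f \<in> doubletons B \<Longrightarrow> e \<noteq> f \<Longrightarrow>
                 path_edges (Q e) \<inter> path_edges (Q f) = {}"
    by (rule clique_immersionE[OF assms(1)]) (rule that)
  obtain C where C: "C \<subseteq> B" "card C = k'"
    using obtain_subset_with_card_n assms(2) B(2) by metis
  have sub: "doubletons C \<subseteq> doubletons B"
    using C(1) by (auto simp: doubletons_def)
  show ?thesis
  proof (rule clique_immersionI[where R = "\<lambda>e p. p = Q e" and B = C])
    fix e p assume "e \<in> doubletons C" "p = Q e"
    then show "strong_path adj V' C e p"
      using Q[of e] sub C(1) assms(3) unfolding strong_path_def by (meson disjoint_iff order_trans subsetD)
  next
    show "C \<subseteq> V'" using B C assms(3) by blast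
    fix e f p q assume "e \<in> doubletons C" "f \<in> doubletons C" "e \<noteq> f" "p = Q e" "q = Q f"
    then show "path_edges p \<inter> path_edges q = {}" using disj[of e f] sub by blast
  qed (use C in auto)
qed

lemma path_edges_subset:
  assumes "f \<in> path_edges p" shows "f \<subseteq> set p"
proof -
  have "u \<in> set p \<and> v \<in> set p" if "(u, v) \<in> set (vwalk_arcs p)" for u v
    using that by (induction p rule: vwalk_arcs.induct) auto
  with assms show ?thesis by (auto simp: path_edges_def)
qed

lemma path_edges_strong_path:
  assumes "strong_path adj V B e p" "f \<in> path_edges p"
  shows "f \<subseteq> V"
  using assms path_edges_subset unfolding strong_path_def by blast

lemma path_edges_nonempty: "{} \<notin> path_edges p"
  by (auto simp: path_edges_def)

text \<open>The paths of each side stay inside that side, and a pair with one end on each side is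
  joined by a single edge of the join, which no path inside a side can use.\<close>

lemma clique_immersion_join:
  assumes "clique_immersion adj V k" "clique_immersion adj W l" "finite V" "finite W" "V \<inter> W = {}"
    and join: "\<And>u v. u \<in> V \<Longrightarrow> v \<in> W \<Longrightarrow> adj u v"
  shows "clique_immersion adj (V \<union> W) (k + l)"
proof -
  obtain B Q where B: "B \<subseteq> V" "card B = k"
    and Q: "\<And>e. e \<in> doubletons B \<Longrightarrow> strong_path adj V B e (Q e)"
    and dQ: "\<And>e f. e \<in> doubletons B \<Longrightarrow> f \<in> doubletons B \<Longrightarrow> e \<noteq> f \<Longrightarrow>
                 path_edges (Q e) \<inter> path_edges (Q f) = {}"
    by (rule clique_immersionE[OF assms(1)]) (rule that)
  obtain C P where C: "C \<subseteq> W" "card C = l"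
    and P: "\<And>e. e \<in> doubletons C \<Longrightarrow> strong_path adj W C e (P e)"
    and dP: "\<And>e f. e \<in> doubletons C \<Longrightarrow> f \<in> doubletons C \<Longrightarrow> e \<noteq> f \<Longrightarrow>
                 path_edges (P e) \<inter> path_edges (P f) = {}"
    by (rule clique_immersionE[OF assms(2)]) (rule that)
  define R where "R e p \<longleftrightarrow> e \<in> doubletons B \<and> p = Q e \<or> e \<in> doubletons C \<and> p = P e \<or>
      (\<exists>u \<in> B. \<exists>v \<in> C. e = {u, v} \<and> p = [u, v])" for e p
  \<comment> \<open>The empty set is removed because it is the only common element of
    \<open>Pow V\<close> and \<open>Pow W\<close>; without it the two families are disjoint.\<close>
  have RQ: "path_edges p \<subseteq> Pow V - {{}}" if "e \<in> doubletons B" "p = Q e" for e p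
    using that path_edges_strong_path[OF Q] path_edges_nonempty by blast
  have RP: "path_edges p \<subseteq> Pow W - {{}}" if "e \<in> doubletons C" "p = P e" for e p
    using that path_edges_strong_path[OF P] path_edges_nonempty by blast
  have cases: thesis
    if "R e p" "e \<in> doubletons B \<Longrightarrow> p = Q e \<Longrightarrow> path_edges p \<subseteq> Pow V - {{}} \<Longrightarrow> thesis"
      "e \<in> doubletons C \<Longrightarrow> p = P e \<Longrightarrow> path_edges p \<subseteq> Pow W - {{}} \<Longrightarrow> thesis"
      "path_edges p = {e} \<Longrightarrow> \<not> e \<subseteq> V \<Longrightarrow> \<not> e \<subseteq> W \<Longrightarrow> thesis" for e p thesis
  proof -
    have "path_edges p = {e} \<and> \<not> e \<subseteq> V \<and> \<not> e \<subseteq> W"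
      if "u \<in> B" "v \<in> C" "e = {u, v}" "p = [u, v]" for u v
      using that B(1) C(1) assms(5) by (auto simp: path_edges_2)
    then show ?thesis using that RQ RP unfolding R_def by metis
  qed
  have VW: "X \<inter> Y = {}" if "X \<subseteq> Pow V - {{}}" "Y \<subseteq> Pow W - {{}}" for X Y
    using that assms(5) by blast
  have cross: "path_edges p \<inter> path_edges q = {}" if "R e p" "R f q" "e \<noteq> f" for e f p q
    apply (rule cases[OF \<open>R e p\<close>]; rule cases[OF \<open>R f q\<close>])
            apply (metis dQ \<open>e \<noteq> f\<close>)
           apply (rule VW; assumption)
          apply blast
         apply (subst Int_commute, rule VW; assumption)
        apply (metis dP \<open>e \<noteq> f\<close>)
       apply blast
      apply blast
     apply blast
    using \<open>e \<noteq> f\<close> apply simp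
    done
  show ?thesis
  proof (rule clique_immersionI[where R = R and B = "B \<union> C"])
    show "card (B \<union> C) = k + l"
      using B C assms(3-5) by (subst card_Un_disjoint) (auto intro: finite_subset)
    show "\<exists>p. R e p" if "e \<in> doubletons (B \<union> C)" for e
    proof -
      obtain u v where e: "e = {u, v}" "u \<in> B \<union> C" "v \<in> B \<union> C" "u \<noteq> v"
        using \<open>e \<in> doubletons (B \<union> C)\<close> unfolding doubletons_def by blast
      then consider "e \<in> doubletons B" | "e \<in> doubletons C" | "u \<in> B" "v \<in> C" | "v \<in> B" "u \<in> C"
        unfolding doubletons_def by blast
      then show ?thesis using e(1) unfolding R_def by cases (blast, blast, blast, metis insert_commute)
    qed
    fix e p assume "R e p"
    then consider "e \<in> doubletons B" "p = Q e" | "e \<in> doubletons C" "p = P e"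
      | u v where "u \<in> B" "v \<in> C" "e = {u, v}" "p = [u, v]"
      unfolding R_def by blast
    then show "strong_path adj (V \<union> W) (B \<union> C) e p"
    proof cases
      case 1
      then have "strong_path adj V B e p" using Q by simp
      moreover have "set (butlast (tl p)) \<subseteq> set p"
        by (cases p) (auto dest: in_set_butlastD)
      ultimately show ?thesis using C(1) assms(5) unfolding strong_path_def by blast
    next
      case 2
      then have "strong_path adj W C e p" using P by simp
      moreover have "set (butlast (tl p)) \<subseteq> set p"
        by (cases p) (auto dest: in_set_butlastD)
      ultimately show ?thesis using B(1) assms(5) unfolding strong_path_def by blast
    next
      case 3
      then show ?thesis using strong_path_edge[of adj u v "V \<union> W"] join B(1) C(1) assms(5) by blast
    qed
  qed (use B(1) C(1) cross in auto)
qed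

section \<open>Cyclically ordered graphs\<close>

lemma shift_mult:
  fixes F :: "int \<Rightarrow> int"
  assumes "\<And>x. F (x + n) = F x + n"
  shows "F (x + k * n) = F x + k * n"
proof (induction k rule: int_induct[where k = 0])
  case (step1 k)
  have "F (x + (k + 1) * n) = F (x + k * n + n)" by (simp add: algebra_simps)
  also have "\<dots> = F (x + k * n) + n" by (rule assms)
  also have "\<dots> = F x + (k + 1) * n" using step1 by (simp add: algebra_simps)
  finally show ?case .
next
  case (step2 k)
  have "F (x + (k - 1) * n) + n = F (x + (k - 1) * n + n)" by (rule assms[symmetric])
  also have "x + (k - 1) * n + n = x + k * n" by (simp add: algebra_simps)
  finally show ?case using step2 by (simp add: algebra_simps)
qed simp

text \<open>
  The vertices \<open>v x\<close> are in cyclic order, and \<open>F x\<close> is the first one after \<open>x\<close> that need not be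
  adjacent to \<open>x\<close>. The branch vertices are the \<open>m\<close> vertices preceding one with the longest run of
  forward neighbours, of length \<open>M - 1\<close>, and \<open>i < c\<close> with \<open>F i \<le> c\<close> are joined by the path
  \<open>c, i + m, c + M, i\<close>.
\<close>

lemma cyclic_clique_immersion:
  fixes F :: "int \<Rightarrow> int" and v :: "int \<Rightarrow> 'a"
  assumes n: "n = 2 * m - 1" "1 \<le> m"
    and F_mono: "\<And>x y. x \<le> y \<Longrightarrow> F x \<le> F y"
    and F_shift: "\<And>x. F (x + n) = F x + n"
    and F3: "\<And>x. x + n < F (F (F x))"
    and v_inj: "\<And>x y. v x = v y \<Longrightarrow> \<bar>x - y\<bar> < n \<Longrightarrow> x = y"
    and v_shift: "\<And>x. v (x + n) = v x"
    and v_mem: "\<And>x. v x \<in> V"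
    and adj: "\<And>x y. x < y \<Longrightarrow> y < F x \<Longrightarrow> adj (v x) (v y)"
    and sym: "\<And>x y. adj x y \<Longrightarrow> adj y x"
  shows "clique_immersion adj V (nat m)"
proof -
  have inj: "inj_on v {x..<y}" if "y \<le> x + n" for x y
    by (intro inj_onI v_inj) (use that in auto)
  show ?thesis
  proof (cases "\<exists>x. m \<le> F x - x")
    case True
    then obtain x where x: "m \<le> F x - x" by blast
    show ?thesis
    proof (rule clique_immersion_clique)
      show "card (v ` {x..<x + m}) = nat m"
        using inj n by (subst card_image) auto
      have adj': "adj (v a) (v b) \<and> adj (v b) (v a)" if "x \<le> a" "a < b" "b < x + m" for a b
      proof -
        have "b < F a" using F_mono[of x a] x that by linarith
        then show ?thesis using adj sym that(2) by blast
      qed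
      fix u w assume "u \<in> v ` {x..<x + m}" "w \<in> v ` {x..<x + m}" "u \<noteq> w"
      then obtain a b where "u = v a" "w = v b" "a \<in> {x..<x + m}" "b \<in> {x..<x + m}" "a \<noteq> b"
        by blast
      then show "adj u w" using adj'[of a b] adj'[of b a] by (cases "a < b") auto
    qed (use v_mem in auto)
  next
    case False
    \<comment> \<open>\<open>F x - x\<close> has period \<open>n\<close>, so the maximum over one
      period bounds it everywhere.\<close>
    define M where "M = Max ((\<lambda>x. F x - x) ` {0..<n})"
    have "M \<in> (\<lambda>x. F x - x) ` {0..<n}"
      unfolding M_def using n by (intro Max_in) auto
    then obtain s where s: "F s - s = M" by auto
    have M: "F x - x \<le> M" for x
    proof -
      have "x = x mod n + x div n * n" by simp
      then have "F x = F (x mod n) + x div n * n" using shift_mult[of F n] F_shift by metis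
      then have "F x - x = F (x mod n) - x mod n" by (simp add: minus_mod_eq_div_mult[symmetric])
      also have "\<dots> \<le> M" unfolding M_def using n by (intro Max_ge) auto
      finally show ?thesis .
    qed
    have Mm: "M < m" using False s by (metis linorder_not_less)
    \<comment> \<open>The window of \<open>m\<close> branch positions ends just before
      \<open>s\<close>, so the first position after the window attains the maximum
      \<open>M\<close>.\<close>
    define start where "start = s - m"
    have base: "F (start + m) = start + m + M" using s by (simp add: start_def)
    \<comment> \<open>\<open>E i c\<close> lists the edges of \<open>p i c\<close> by integer
      positions. They all lie in one window of length \<open>n\<close>, where \<open>v\<close> is
      injective, so edge-disjointness becomes arithmetic on positions.\<close>
    define E where "E i c = (if c < F i then {{i, c}} else {{c, i + m}, {i + m, c + M}, {c + M, i}})" for i c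
    define p where "p i c = (if c < F i then [v i, v c] else [v c, v (i + m), v (c + M), v i])" for i c
    \<comment> \<open>These bounds make \<open>c\<close>, \<open>i + m\<close>,
      \<open>c + M\<close>, \<open>i + n\<close> an increasing sequence in which each term lies
      below \<open>F\<close> of the preceding one. The first bound comes from \<open>F3\<close>; the
      others use the maximality of \<open>M\<close> and \<open>M < m\<close>.\<close>
    have far: "i + n < F (F c) \<and> i + m < F c \<and> F c \<le> c + M \<and> c + M < F (i + m) \<and> c + M < start + n"
      if "start \<le> i" "i < c" "c < start + m" "F i \<le> c" for i c
    proof -
      have "i + n < F (F c)"
      proof (rule ccontr)
        assume "\<not> i + n < F (F c)"
        then have "F (F (F c)) \<le> F i + n" using F_mono[of "F (F c)" "i + n"] F_shift by simp
        then show False using F3[of c] that(4) by linarith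
      qed
      moreover have "F (F c) \<le> F c + M" "F c \<le> c + M" using M[of "F c"] M[of c] by auto
      moreover have "F (start + m) \<le> F (i + m)" using that by (intro F_mono) simp
      ultimately show ?thesis using that Mm n base by linarith
    qed
    have E_sub: "E i c \<subseteq> Pow {start..<start + n}" if "start \<le> i" "i < c" "c < start + m" for i c
      using far[OF that] that n unfolding E_def by auto
    have edges: "path_edges (p i c) = (`) v ` E i c" for i c
      by (simp add: p_def E_def path_edges_2 path_edges_4)
    \<comment> \<open>The ends of a middle edge are ordered by \<open>i + m < c + M\<close>, so they
      determine \<open>i\<close> and \<open>c\<close>. An edge \<open>{c, i + m}\<close> is never an
      edge \<open>{c' + M, i'}\<close>: with \<open>i' = c\<close> one gets
      \<open>c' + M > c + M > i + m\<close>.\<close>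
    have E_disj: "E i c \<inter> E i' c' = {}"
      if "start \<le> i" "i < c" "c < start + m" "start \<le> i'" "i' < c'" "c' < start + m" "(i, c) \<noteq> (i', c')" for i c i' c'
      using far[OF that(1-3)] far[OF that(4-6)] that unfolding E_def
      by (auto simp: doubleton_eq_iff)
    define B where "B = v ` {start..<start + m}"
    define R where "R e q \<longleftrightarrow> (\<exists>i c. start \<le> i \<and> i < c \<and> c < start + m \<and> e = {v i, v c} \<and> q = p i c)" for e q
    show ?thesis
    proof (rule clique_immersionI[where B = B and R = R])
      show "card B = nat m"
        unfolding B_def using inj n by (subst card_image) auto
      show "B \<subseteq> V" using v_mem by (auto simp: B_def)
      show "\<exists>q. R e q" if e: "e \<in> doubletons B" for e
      proof -
        obtain i c where ic: "e = {v i, v c}" "start \<le> i" "i < start + m" "start \<le> c" "c < start + m" "v i \<noteq> v c"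
          using e unfolding doubletons_def B_def by auto
        then have "i < c \<or> c < i" by (metis linorder_neqE)
        then show ?thesis
          unfolding R_def using ic by (metis insert_commute)
      qed
      fix e q assume e: "R e q"
      then obtain i c where ic: "start \<le> i" "i < c" "c < start + m" "e = {v i, v c}" "q = p i c"
        unfolding R_def by blast
      show "strong_path adj V B e q"
      proof (cases "c < F i")
        case True
        have "v i \<noteq> v c" using v_inj[of i c] ic n by auto
        then show ?thesis
          using True ic adj[of i c] v_mem strong_path_edge[of adj "v i" "v c"] by (simp add: p_def)
      next
        case False
        then have f: "i + n < F (F c)" "i + m < F c" "F c \<le> c + M" "c + M < F (i + m)" "c + M < start + n"
          using far ic by auto
        \<comment> \<open>The path goes once around the circle: its last edge leads forwards to
          position \<open>i + n\<close>, which is the vertex \<open>v i\<close> again.\<close>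
        have "adj (v (c + M)) (v (i + n))"
          using f F_mono[of "F c" "c + M"] ic by (intro adj) auto
        moreover have "adj (v c) (v (i + m))" "adj (v (i + m)) (v (c + M))"
          using f ic by (auto intro!: adj)
        moreover have ne: "v x \<noteq> v y" if "x \<in> {start..<start + n}" "y \<in> {start..<start + n}" "x \<noteq> y" for x y
          using inj_onD[OF inj[of "start + n" start]] that by blast
        moreover have "distinct [v c, v (i + m), v (c + M), v i]"
          using f ic n by (simp, intro conjI ne) auto
        moreover have "v x \<notin> B" if "start + m \<le> x" "x < start + n" for x
        proof
          assume "v x \<in> B"
          then obtain y where "v x = v y" "start \<le> y" "y < start + m" by (auto simp: B_def)
          then show False using ne[of x y] that n by auto
        qed
        ultimately show ?thesis
          using f ic v_mem False by (auto simp: strong_path_def p_def v_shift)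
      qed
      fix e' q' assume "R e' q'" and "e \<noteq> e'"
      then obtain i' c' where ic': "start \<le> i'" "i' < c'" "c' < start + m" "e' = {v i', v c'}" "q' = p i' c'"
        unfolding R_def by blast
      then have "(i, c) \<noteq> (i', c')" using \<open>e \<noteq> e'\<close> ic by auto
      then have "E i c \<inter> E i' c' = {}" using E_disj ic(1-3) ic'(1-3) by blast
      moreover have "inj_on ((`) v) (E i c \<union> E i' c')"
        by (rule inj_on_subset[OF inj_on_image_Pow[OF inj[of "start + n" start]]])
          (use E_sub[OF ic(1-3)] E_sub[OF ic'(1-3)] in auto)
      ultimately show "path_edges q \<inter> path_edges q' = {}"
        unfolding ic(5) ic'(5) edges by (metis image_empty inj_on_image_Int sup_ge1 sup_ge2)
    qed
  qed
qed

text \<open>Non-adjacent vertices have images at cyclic distance at least \<open>d\<close>. With the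
  vertices sorted by \<open>h\<close> and repeated periodically, \<open>F\<close> moves on to the
  first position whose image lies at least \<open>d\<close> further. Three such moves gain at least
  \<open>3 * d\<close>, more than the circumference \<open>3 * d - 1\<close>.\<close>

lemma andrasfai_clique_immersion:
  assumes V: "finite V" "card V = 2 * m - 1" "1 \<le> m"
    and h: "\<And>u. u \<in> V \<Longrightarrow> h u \<in> {1..3 * d - 1}"
    and hom: "\<And>u w. u \<in> V \<Longrightarrow> w \<in> V \<Longrightarrow> u \<noteq> w \<Longrightarrow> \<not> adj u w \<Longrightarrow>
                (h u, h w) \<in> parcs (andrasfai_graph d)"
    and sym: "\<And>x y. adj x y \<Longrightarrow> adj y x"
  shows "clique_immersion adj V m"
proof -
  obtain ys where ys: "distinct ys" "set ys = V"
    using finite_distinct_list[OF V(1)] by blast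
  define xs where "xs = sort_key h ys"
  have xs: "distinct xs" "set xs = V" "sorted (map h xs)"
    using ys by (auto simp: xs_def)
  then have len: "length xs = 2 * m - 1" using V(2) distinct_card by metis
  define n where "n = 2 * int m - 1"
  define N where "N = 3 * int d - 1"
  define v where "v z = xs ! nat (z mod n)" for z
  have n: "0 < n" "nat n = length xs" using V(3) len by (auto simp: n_def)
  have idx: "nat (z mod n) < length xs" for z
    using n pos_mod_bound[OF n(1), of z] pos_mod_sign[OF n(1), of z] by linarith
  have v_mem: "v z \<in> V" for z using idx xs(2) by (auto simp: v_def)
  have hv: "1 \<le> int (h (v z)) \<and> int (h (v z)) \<le> N" for z
    using h[OF v_mem[of z]] by (auto simp: N_def)
  have d: "0 < int d" using hv[of 0] by (auto simp: N_def)
  \<comment> \<open>The image of position \<open>z\<close> is lifted from the circle of length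
    \<open>N\<close> to the integers, with \<open>N\<close> added for every full turn.\<close>
  define p where "p z = int (h (v z)) + N * (z div n)" for z
  have p_mono: "p x \<le> p y" if "x \<le> y" for x y
  proof (cases "x div n = y div n")
    case True
    have "x mod n \<le> y mod n" using that True by (simp add: minus_div_mult_eq_mod[symmetric])
    then have "map h xs ! nat (x mod n) \<le> map h xs ! nat (y mod n)"
      using xs(3) idx[of y] by (intro sorted_nth_mono) auto
    then show ?thesis using True idx by (simp add: p_def v_def)
  next
    case False
    then have "x div n + 1 \<le> y div n" using zdiv_mono1[OF that n(1)] by simp
    then have "N * (x div n + 1) \<le> N * (y div n)" using d by (intro mult_left_mono) (auto simp: N_def)
    then show ?thesis using hv[of x] hv[of y] by (simp add: p_def algebra_simps)
  qed
  have v_shift: "v (x + n) = v x" for x by (simp add: v_def)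
  have p_shift: "p (x + n) = p x + N" for x
    unfolding p_def v_shift using n by (simp add: algebra_simps)
  define F where "F z = z + int (LEAST j. p z + d \<le> p (z + int j))" for z
  \<comment> \<open>A full turn raises \<open>p\<close> by \<open>N\<close>, and \<open>N\<close> is
    at least \<open>d\<close> because \<open>d\<close> is positive; hence the \<open>LEAST\<close>
    in \<open>F\<close> is attained.\<close>
  have ex: "p z + d \<le> p (z + int (nat n))" for z
    using n(1) d p_shift[of z] by (simp add: N_def)
  \<comment> \<open>This equivalence characterises \<open>F\<close>; its monotonicity, its
    periodicity and the bound on three steps are all read off from it.\<close>
  have galois: "F z \<le> z' \<longleftrightarrow> p z + d \<le> p z'" for z z'
  proof
    assume "F z \<le> z'"
    then show "p z + d \<le> p z'"
      using p_mono[of "F z" z'] LeastI[of "\<lambda>j. p z + d \<le> p (z + int j)", OF ex[of z]]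
      by (simp add: F_def)
  next
    assume *: "p z + d \<le> p z'"
    have "z \<le> z'" using p_mono[of z' z] * d by linarith
    then obtain j where "z' = z + int j" using zle_iff_zadd by blast
    then show "F z \<le> z'"
      using * Least_le[of "\<lambda>j. p z + d \<le> p (z + int j)" j] by (simp add: F_def)
  qed
  have F_shift: "F (x + n) = F x + n" for x
  proof (rule antisym)
    show "F (x + n) \<le> F x + n" using galois[of x "F x"] by (simp add: galois p_shift)
    have "F x \<le> F (x + n) - n"
      using galois[of "x + n" "F (x + n)"] p_shift[of x] p_shift[of "F (x + n) - n"]
      by (simp add: galois)
    then show "F x + n \<le> F (x + n)" by simp
  qed
  have v_inj: "x = y" if "v x = v y" "\<bar>x - y\<bar> < n" for x y
  proof -
    have "nat (x mod n) = nat (y mod n)"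
      using that(1) idx xs(1) nth_eq_iff_index_eq unfolding v_def by metis
    then have "x mod n = y mod n" using n(1) pos_mod_sign[OF n(1)] by (metis nat_0_le)
    then have "n dvd x - y" by (simp add: mod_eq_dvd_iff)
    then show ?thesis using that(2) zdvd_imp_le[of n "\<bar>x - y\<bar>"] by fastforce
  qed
  have "clique_immersion adj V (nat (int m))"
  proof (rule cyclic_clique_immersion[where F = F and v = v and n = n])
    show "F x \<le> F y" if "x \<le> y" for x y
      using p_mono[OF that] galois[of y "F y"] by (simp add: galois)
    show "x + n < F (F (F x))" for x
    proof (rule ccontr)
      assume "\<not> x + n < F (F (F x))"
      then have "p (F (F x)) + d \<le> p x + N" by (simp add: galois p_shift linorder_not_less)
      moreover have "p (F x) + d \<le> p (F (F x))" "p x + d \<le> p (F x)"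
        using galois by blast+
      ultimately show False by (simp add: N_def)
    qed
    show "adj (v x) (v y)" if "x < y" "y < F x" for x y
    proof (rule ccontr)
      assume "\<not> adj (v x) (v y)"
      have near: "0 \<le> p y - p x" "p y - p x < d"
        using that p_mono[of x y] galois[of x y] by auto
      have "F x \<le> x + n" using ex[of x] n(1) by (simp add: galois)
      then have "v x \<noteq> v y" using v_inj[of x y] that by auto
      then have "(h (v x), h (v y)) \<in> parcs (andrasfai_graph d)"
        using hom v_mem \<open>\<not> adj (v x) (v y)\<close> by blast
      then obtain i where i: "d \<le> i" "i \<le> 2 * d - 1" "[h (v y) = h (v x) + i] (mod (3 * d - 1))"
        by (auto simp: andrasfai_graph_def)
      have "[int (h (v y)) = int (h (v x) + i)] (mod int (3 * d - 1))"
        using i(3) by (simp only: cong_int_iff)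
      moreover have "int (3 * d - 1) = N" using d by (simp add: N_def)
      ultimately have "[int (h (v x)) + int i = int (h (v y))] (mod N)"
        by (simp only: of_nat_add cong_sym)
      then have "N dvd int (h (v x)) + int i - int (h (v y))"
        by (simp only: cong_iff_dvd_diff)
      \<comment> \<open>Adding a multiple of \<open>N\<close> replaces the images by their lifts.
        The resulting number is positive, as \<open>i\<close> is at least \<open>d\<close> and
        \<open>p y - p x\<close> is below \<open>d\<close>, yet at most \<open>2 * d - 1\<close>,
        which is less than \<open>N\<close>.\<close>
      then have "N dvd int (h (v x)) + int i - int (h (v y)) + N * (x div n - y div n)"
        by simp
      also have "\<dots> = int i - (p y - p x)" by (simp add: p_def algebra_simps)
      finally have "N \<le> int i - (p y - p x)"
        using near i(1) by (intro zdvd_imp_le) auto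
      then show False using i(1,2) near d by (simp add: N_def)
    qed
  qed (use V(3) v_inj v_shift v_mem F_shift sym in \<open>auto simp: n_def\<close>)
  then show ?thesis by simp
qed

section \<open>Gallai's lemma\<close>

text \<open>A pair counts as an edge when it is related by \<open>R\<close> in at least one
  direction, so matchings live in the undirected graph underlying \<open>R\<close>.\<close>

definition matching :: "('a \<Rightarrow> 'a \<Rightarrow> bool) \<Rightarrow> 'a set \<Rightarrow> 'a set set \<Rightarrow> bool" where
  "matching R V M \<longleftrightarrow>
     (\<forall>e \<in> M. \<exists>u \<in> V. \<exists>v \<in> V. u \<noteq> v \<and> R u v \<and> e = {u, v}) \<and> pairwise disjnt M"

lemma matching_Union_subset: "matching R V M \<Longrightarrow> \<Union> M \<subseteq> V"
  by (auto simp: matching_def)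

lemma finite_matching:
  assumes "finite V" "matching R V M" shows "finite M"
proof (rule finite_subset)
  show "M \<subseteq> Pow V" using matching_Union_subset[OF assms(2)] by blast
qed (use assms in simp)

lemma matching_mono: "matching R V M \<Longrightarrow> V \<subseteq> W \<Longrightarrow> matching R W M"
  unfolding matching_def by (meson subsetD)

lemma card_Union_matching:
  assumes "matching R V M" shows "card (\<Union> M) = 2 * card M"
proof -
  have c: "card e = 2" "finite e" if "e \<in> M" for e
    proof -
    obtain u v where "u \<noteq> v" "e = {u, v}" using assms \<open>e \<in> M\<close> unfolding matching_def by blast
    then show "card e = 2" "finite e" by auto
  qed
  then have "card (\<Union> M) = (\<Sum>e \<in> M. card e)"
    using assms by (intro card_Union_disjoint) (auto simp: matching_def)
  then show ?thesis using c by simp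
qed

lemma matching_insert:
  assumes "matching R V M" "R u v" "u \<noteq> v" "u \<in> V - \<Union> M" "v \<in> V - \<Union> M"
  shows "matching R V (insert {u, v} M)" "finite M \<Longrightarrow> card (insert {u, v} M) = Suc (card M)"
proof -
  show "matching R V (insert {u, v} M)"
    using assms unfolding matching_def pairwise_insert by (auto simp: disjnt_def)
  have "{u, v} \<notin> M" using assms(4) by blast
  then show "card (insert {u, v} M) = Suc (card M)" if "finite M" using that by simp
qed

text \<open>
  Among the maximum matchings missing \<open>w\<close>, take one that shares as many edges with \<open>M\<close> as
  possible: an edge of \<open>M\<close> at a vertex missed by it could be exchanged in.
\<close>

lemma gallai_exchange:
  assumes fin: "finite V"
    and max: "\<And>M. matching R V M \<Longrightarrow> card M \<le> k"
    and M: "matching R V M" "card M = k" "u \<notin> \<Union> M" "x \<notin> \<Union> M"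
    and N0: "matching R V N0" "card N0 = k" "w \<notin> \<Union> N0"
    and in_V: "u \<in> V" "x \<in> V" "u \<noteq> x"
    and wM: "w \<in> \<Union> M"
    and cover: "\<And>K. matching R V K \<Longrightarrow> card K = k \<Longrightarrow> w \<notin> \<Union> K \<Longrightarrow> u \<in> \<Union> K \<and> x \<in> \<Union> K"
  shows False
proof -
  define S where "S N \<longleftrightarrow> matching R V N \<and> card N = k \<and> w \<notin> \<Union> N" for N
  have finM: "finite M" using finite_matching[OF fin M(1)] .
  obtain N where N: "S N" and N_max: "\<And>N'. S N' \<Longrightarrow> card (M \<inter> N') \<le> card (M \<inter> N)"
  proof -
    have "\<exists>N. S N \<and> (\<forall>N'. S N' \<longrightarrow> card (M \<inter> N') \<le> card (M \<inter> N))"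
    proof (rule ex_has_greatest_nat[where k = N0 and b = "Suc (card M)"])
      show "S N0" using N0 by (simp add: S_def)
      show "\<forall>y. S y \<longrightarrow> card (M \<inter> y) < Suc (card M)"
        using finM by (simp add: card_mono less_Suc_eq_le)
    qed
    then show ?thesis using that by blast
  qed
  have N': "matching R V N" "card N = k" "w \<notin> \<Union> N" using N by (auto simp: S_def)
  have finN: "finite N" using finite_matching[OF fin N'(1)] .
  have finU: "finite (\<Union> M)" "finite (\<Union> N)"
    using matching_Union_subset M(1) N'(1) fin finite_subset by metis+
  have uxN: "u \<in> \<Union> N" "x \<in> \<Union> N" using cover[OF N'] by auto
  \<comment> \<open>\<open>M\<close> and \<open>N\<close> cover equally many vertices, and
    \<open>u\<close> and \<open>x\<close> are covered by \<open>N\<close> only. So at least two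
    vertices are covered by \<open>M\<close> only, and one of them differs from
    \<open>w\<close>.\<close>
  have "card (\<Union> M) = card (\<Union> N)"
    using card_Union_matching M(1,2) N'(1,2) by metis
  then have "card (\<Union> M - \<Union> N) = card (\<Union> N - \<Union> M)"
    using finU by (simp add: card_Diff_subset_Int Int_commute)
  moreover have "card {u, x} \<le> card (\<Union> N - \<Union> M)"
    using finU uxN M(3,4) by (intro card_mono) auto
  ultimately have "\<not> \<Union> M - \<Union> N \<subseteq> {w}"
    using in_V(3) card_mono[of "{w}" "\<Union> M - \<Union> N"] by auto
  then obtain a where a: "a \<in> \<Union> M" "a \<notin> \<Union> N" "a \<noteq> w" by blast
  then obtain e b where e: "e \<in> M" "e = {a, b}" "a \<noteq> b" "a \<in> V" "b \<in> V" "R a b \<or> R b a"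
  proof -
    obtain e where "e \<in> M" "a \<in> e" using a(1) by blast
    moreover obtain c d where "c \<in> V" "d \<in> V" "c \<noteq> d" "R c d" "e = {c, d}"
      using M(1) \<open>e \<in> M\<close> unfolding matching_def by blast
    ultimately show ?thesis using that[of e c] that[of e d] by auto
  qed
  have b: "b \<in> \<Union> N"
  proof (rule ccontr)
    assume "b \<notin> \<Union> N"
    then have ab: "a \<in> V - \<Union> N" "b \<in> V - \<Union> N" using e(4,5) a(2) by auto
    have "\<exists>K. matching R V K \<and> card K = Suc k"
      using e(6)
    proof
      assume "R a b"
      from matching_insert[OF N'(1) this e(3) ab] show ?thesis using N'(2) finN by metis
    next
      assume "R b a"
      from matching_insert[OF N'(1) this e(3)[symmetric] ab(2,1)] show ?thesis
        using N'(2) finN by metis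
    qed
    then show False using max by fastforce
  qed
  then obtain g where g: "g \<in> N" "b \<in> g" by blast
  \<comment> \<open>The exchange: \<open>e\<close> from \<open>M\<close> replaces the edge
    \<open>g\<close> of \<open>N\<close> at \<open>b\<close>. The result still misses
    \<open>w\<close>, since \<open>a\<close> differs from \<open>w\<close> and \<open>b\<close> is
    covered by \<open>N\<close>, and it shares one more edge with \<open>M\<close>, since
    \<open>g\<close> meets \<open>e\<close> and so is not in \<open>M\<close>.\<close>
  define K where "K = insert e (N - {g})"
  have "e \<notin> N" using a(2) e(2) by blast
  then have cardK: "card K = k"
    using g(1) finN N'(2) card_Suc_Diff1[OF finN g(1)] by (simp add: K_def)
  have "disjnt e f" if "f \<in> N - {g}" for f
  proof -
    have "b \<notin> f" using N'(1) g that unfolding matching_def pairwise_def disjnt_iff by blast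
    moreover have "a \<notin> f" using a(2) that by blast
    ultimately show ?thesis by (simp add: e(2))
  qed
  moreover have "pairwise disjnt (N - {g})"
    using N'(1) unfolding matching_def by (auto intro: pairwise_subset)
  ultimately have "pairwise disjnt K"
    unfolding K_def pairwise_insert by (auto simp: disjnt_sym)
  then have "matching R V K"
    using N'(1) M(1) e(1) unfolding matching_def K_def by blast
  moreover have "w \<notin> \<Union> K"
    using N'(3) a(3) b e(2) unfolding K_def by blast
  ultimately have "S K" using cardK by (simp add: S_def)
  have "g \<notin> M"
  proof
    assume "g \<in> M"
    then have "g = e \<or> disjnt g e" using M(1) e(1) unfolding matching_def pairwise_def by blast
    then have "g = e" using e(2) g(2) by (auto simp: disjnt_def)
    then show False using g(1) \<open>e \<notin> N\<close> by simp
  qed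
  then have "M \<inter> K = insert e (M \<inter> N)" using e(1) by (auto simp: K_def)
  then have "card (M \<inter> K) = Suc (card (M \<inter> N))" using \<open>e \<notin> N\<close> finM by simp
  then show False using N_max[OF \<open>S K\<close>] by simp
qed

text \<open>Call two vertices related if they are equal or no maximum matching misses both. The
  exchange argument makes this transitive, and adjacent vertices are related since their edge could
  otherwise be added. By connectedness all vertices are related, so a maximum matching missing one
  vertex covers all others.\<close>

lemma gallai:
  assumes fin: "finite V" "V \<noteq> {}"
    and max: "\<And>M. matching R V M \<Longrightarrow> card M \<le> k"
    and miss: "\<And>v. v \<in> V \<Longrightarrow> \<exists>M. matching R (V - {v}) M \<and> card M = k"
    and conn: "\<And>U. U \<subseteq> V \<Longrightarrow> U \<noteq> {} \<Longrightarrow> U \<noteq> V \<Longrightarrow> \<exists>u \<in> U. \<exists>w \<in> V - U. R u w"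
  shows "card V = 2 * k + 1"
proof -
  define S where "S u w \<longleftrightarrow> u = w \<or>
    \<not> (\<exists>M. matching R V M \<and> card M = k \<and> u \<notin> \<Union> M \<and> w \<notin> \<Union> M)" for u w
  have miss': "\<exists>M. matching R V M \<and> card M = k \<and> v \<notin> \<Union> M" if "v \<in> V" for v
    using miss[OF that] matching_Union_subset matching_mono by (metis Diff_iff Diff_subset in_mono insertI1)
  have trans: "S u x" if "S u w" "S w x" "u \<in> V" "w \<in> V" "x \<in> V" for u w x
  proof (rule ccontr)
    assume "\<not> S u x"
    then obtain M where M: "matching R V M" "card M = k" "u \<notin> \<Union> M" "x \<notin> \<Union> M" "u \<noteq> x"
      unfolding S_def by blast
    have "u \<noteq> w" "w \<noteq> x" using that(1,2) \<open>\<not> S u x\<close> by auto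
    then have *: "u \<in> \<Union> K \<or> w \<in> \<Union> K" "w \<in> \<Union> K \<or> x \<in> \<Union> K" if "matching R V K" "card K = k" for K
      using \<open>S u w\<close> \<open>S w x\<close> that unfolding S_def by metis+
    obtain N0 where N0: "matching R V N0" "card N0 = k" "w \<notin> \<Union> N0" using miss' \<open>w \<in> V\<close> by blast
    have wM: "w \<in> \<Union> M" using *(1)[OF M(1,2)] M(3) by simp
    show False
    proof (rule gallai_exchange[OF fin(1) max M(1-4) N0 \<open>u \<in> V\<close> \<open>x \<in> V\<close> \<open>u \<noteq> x\<close> wM])
      show "u \<in> \<Union> K \<and> x \<in> \<Union> K" if "matching R V K" "card K = k" "w \<notin> \<Union> K" for K
        using *[OF that(1,2)] that(3) by simp
    qed
  qed
  obtain v where v: "v \<in> V" using fin(2) by blast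
  define U where "U = {w \<in> V. S v w}"
  have "U = V"
  proof (rule ccontr)
    assume "U \<noteq> V"
    moreover have "v \<in> U" "U \<subseteq> V" using v by (auto simp: U_def S_def)
    ultimately obtain u w where uw: "u \<in> U" "w \<in> V - U" "R u w" using conn[of U] by blast
    have "S u w"
    proof (rule ccontr)
      assume "\<not> S u w"
      then obtain M where M: "matching R V M" "card M = k" "u \<notin> \<Union> M" "w \<notin> \<Union> M" "u \<noteq> w"
        unfolding S_def by blast
      have "card (insert {u, w} M) = Suc k" "matching R V (insert {u, w} M)"
        using matching_insert[OF M(1) uw(3) M(5)] finite_matching[OF fin(1) M(1)] M uw
        by (auto simp: U_def)
      then show False using max by fastforce
    qed
    then show False using trans[of v u w] uw v by (auto simp: U_def)
  qed
  obtain M where M: "matching R V M" "card M = k" "v \<notin> \<Union> M" using miss' v by blast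
  have "w \<in> \<Union> M" if "w \<in> V" "w \<noteq> v" for w
  proof -
    have "S v w" using \<open>U = V\<close> \<open>w \<in> V\<close> by (auto simp: U_def)
    then show ?thesis using M \<open>w \<noteq> v\<close> unfolding S_def by blast
  qed
  then have "\<Union> M = V - {v}"
    using matching_Union_subset[OF M(1)] M(3) by blast
  then show ?thesis
    using card_Union_matching[OF M(1)] M(2) card_Suc_Diff1[OF fin(1) v] by simp
qed

section \<open>Colourings of graphs with independence number two\<close>

definition colorable :: "('a \<Rightarrow> 'a \<Rightarrow> bool) \<Rightarrow> 'a set \<Rightarrow> nat \<Rightarrow> bool" where
  "colorable adj V k \<longleftrightarrow>
     (\<exists>c. c ` V \<subseteq> {..<k} \<and> (\<forall>u \<in> V. \<forall>w \<in> V. u \<noteq> w \<longrightarrow> adj u w \<longrightarrow> c u \<noteq> c w))"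

lemma colorable_mono: "colorable adj V k \<Longrightarrow> k \<le> l \<Longrightarrow> colorable adj V l"
  unfolding colorable_def by (meson lessThan_subset_iff subset_trans)

lemma colorable_join:
  assumes "colorable adj U k" "colorable adj W l"
  shows "colorable adj (U \<union> W) (k + l)"
proof -
  obtain c where c: "c ` U \<subseteq> {..<k}" "\<forall>u \<in> U. \<forall>w \<in> U. u \<noteq> w \<longrightarrow> adj u w \<longrightarrow> c u \<noteq> c w"
    using assms(1) unfolding colorable_def by blast
  obtain d where d: "d ` W \<subseteq> {..<l}" "\<forall>u \<in> W. \<forall>w \<in> W. u \<noteq> w \<longrightarrow> adj u w \<longrightarrow> d u \<noteq> d w"
    using assms(2) unfolding colorable_def by blast
  define b where "b x = (if x \<in> U then c x else k + d x)" for x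
  have "b x < k" if "x \<in> U" for x using c(1) that by (auto simp: b_def)
  moreover have "k \<le> b x \<and> b x < k + l" if "x \<in> W - U" for x using d(1) that by (auto simp: b_def)
  ultimately have "b ` (U \<union> W) \<subseteq> {..<k + l}" by fastforce
  moreover have "b u \<noteq> b w" if uw: "u \<in> U \<union> W" "w \<in> U \<union> W" "u \<noteq> w" "adj u w" for u w
  proof -
    have "c x \<noteq> k + d y" "k + d y \<noteq> c x" if "x \<in> U" for x y using c(1) that by force+
    then show ?thesis using uw c(2) d(2) by (auto simp: b_def)
  qed
  ultimately show ?thesis unfolding colorable_def by blast
qed

text \<open>The colour classes are the edges of the matching and the singletons of uncovered
  vertices, \<open>card M + (card V - 2 * card M)\<close> in number.\<close>

lemma colorable_diff_matching:
  assumes fin: "finite V" and M: "matching (\<lambda>u w. \<not> adj u w) V M"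
    and sym: "\<And>x y. adj x y \<Longrightarrow> adj y x"
  shows "colorable adj V (card V - card M)"
proof -
  define P where "P = M \<union> (\<lambda>x. {x}) ` (V - \<Union> M)"
  have finM: "finite M" using finite_matching[OF fin M] .
  have sub: "\<Union> M \<subseteq> V" using matching_Union_subset[OF M] .
  have "card P \<le> card M + card (V - \<Union> M)"
    unfolding P_def by (rule order_trans[OF card_Un_le]) (simp add: card_image_le fin)
  also have "card (V - \<Union> M) = card V - 2 * card M"
    using card_Diff_subset[OF finite_subset[OF sub fin] sub] card_Union_matching[OF M] by simp
  also have "card M + \<dots> = card V - card M"
    using card_mono[OF fin sub] card_Union_matching[OF M] by simp
  finally have cardP: "card P \<le> card V - card M" .
  have finP: "finite P" using finM fin by (simp add: P_def)
  then obtain g where g: "bij_betw g P {0..<card P}" using ex_bij_betw_finite_nat by blast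
  have "\<forall>x \<in> V. \<exists>e. e \<in> P \<and> x \<in> e" by (auto simp: P_def)
  then obtain f where f: "\<forall>x \<in> V. f x \<in> P \<and> x \<in> f x" by metis
  have "colorable adj V (card P)"
    unfolding colorable_def
  proof (intro exI[of _ "g \<circ> f"] conjI ballI impI)
    show "(g \<circ> f) ` V \<subseteq> {..<card P}" using f bij_betwE[OF g] by auto
    fix u w assume uw: "u \<in> V" "w \<in> V" "u \<noteq> w" "adj u w"
    show "(g \<circ> f) u \<noteq> (g \<circ> f) w"
    proof
      assume "(g \<circ> f) u = (g \<circ> f) w"
      then have "f u = f w" using f uw(1,2) bij_betw_imp_inj_on[OF g] by (auto dest: inj_onD)
      then have "u \<in> f u" "w \<in> f u" "f u \<in> P" using f uw(1,2) by auto
      then have "f u \<in> M" using uw(3) by (auto simp: P_def)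
      then obtain x y where "f u = {x, y}" "\<not> adj x y" using M unfolding matching_def by blast
      then show False using \<open>u \<in> f u\<close> \<open>w \<in> f u\<close> uw(3,4) sym by auto
    qed
  qed
  then show ?thesis using cardP colorable_mono by blast
qed

text \<open>Every colour class has at most two vertices, and the classes with exactly two form the
  matching. Each of the \<open>k\<close> colours accounts for one vertex, plus one more if its class
  is such a pair.\<close>

lemma colorable_imp_matching:
  assumes fin: "finite V" and col: "colorable adj V k"
    and indep: "\<And>S. S \<subseteq> V \<Longrightarrow> (\<forall>u \<in> S. \<forall>w \<in> S. u \<noteq> w \<longrightarrow> \<not> adj u w) \<Longrightarrow> card S \<le> 2"
  shows "\<exists>M. matching (\<lambda>u w. \<not> adj u w) V M \<and> card V \<le> k + card M"
proof -
  obtain c where c: "c ` V \<subseteq> {..<k}" "\<forall>u \<in> V. \<forall>w \<in> V. u \<noteq> w \<longrightarrow> adj u w \<longrightarrow> c u \<noteq> c w"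
    using col unfolding colorable_def by blast
  define C where "C j = {x \<in> V. c x = j}" for j
  have le2: "card (C j) \<le> 2" for j
  proof (intro indep ballI impI notI)
    fix u w assume "u \<in> C j" "w \<in> C j" "u \<noteq> w" "adj u w"
    then show False using c(2) unfolding C_def by (metis (mono_tags, lifting) mem_Collect_eq)
  qed (auto simp: C_def)
  define J where "J = {j \<in> {..<k}. card (C j) = 2}"
  have "inj_on C J"
  proof (rule inj_onI)
    fix i j assume "i \<in> J" "C i = C j"
    then have "C i \<noteq> {}" by (auto simp: J_def)
    then show "i = j" using \<open>C i = C j\<close> by (auto simp: C_def)
  qed
  then have cardM: "card (C ` J) = card J" by (rule card_image)
  have "matching (\<lambda>u w. \<not> adj u w) V (C ` J)"
    unfolding matching_def
  proof (intro conjI ballI)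
    fix e assume "e \<in> C ` J"
    then obtain j u w where e: "e = C j" "e = {u, w}" "u \<noteq> w"
      by (auto simp: J_def card_2_iff)
    then have "u \<in> C j" "w \<in> C j" by auto
    then have "u \<in> V" "w \<in> V" "c u = c w" by (auto simp: C_def)
    then have "\<not> adj u w" using c(2) \<open>u \<noteq> w\<close> by metis
    then show "\<exists>u \<in> V. \<exists>v \<in> V. u \<noteq> v \<and> \<not> adj u v \<and> e = {u, v}"
      using e \<open>u \<in> V\<close> \<open>w \<in> V\<close> by blast
  next
    show "pairwise disjnt (C ` J)"
      unfolding pairwise_def disjnt_def by (auto simp: C_def)
  qed
  moreover have "card V \<le> k + card (C ` J)"
  proof -
    have "card V = (\<Sum>j<k. card (C j))"
      using sum.group[OF fin finite_lessThan c(1), of "\<lambda>_. 1::nat"] by (simp add: C_def)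
    also have "\<dots> \<le> (\<Sum>j<k. 1 + of_bool (card (C j) = 2))"
    proof (rule sum_mono)
      show "card (C j) \<le> 1 + of_bool (card (C j) = 2)" for j using le2[of j] by (cases "card (C j) = 2") auto
    qed
    also have "\<dots> = k + card J"
      unfolding sum.distrib by (simp add: J_def Int_def)
    finally show ?thesis using cardM by simp
  qed
  ultimately show ?thesis by blast
qed

text \<open>The induction is on \<open>card V\<close> with \<open>adj\<close>, \<open>h\<close> and
  \<open>d\<close> fixed and \<open>k\<close> free; the hypotheses on \<open>V\<close> other than
  non-colourability pass to subsets.\<close>

lemma not_colorable_imp_clique_immersion:
  assumes sym: "\<And>x y. adj x y \<Longrightarrow> adj y x"
    and "finite V"
    and "\<And>u. u \<in> V \<Longrightarrow> h u \<in> {1..3 * d - 1}"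
    and "\<And>u w. u \<in> V \<Longrightarrow> w \<in> V \<Longrightarrow> u \<noteq> w \<Longrightarrow> \<not> adj u w \<Longrightarrow>
           (h u, h w) \<in> parcs (andrasfai_graph d)"
    and "\<And>S. S \<subseteq> V \<Longrightarrow> (\<forall>u \<in> S. \<forall>w \<in> S. u \<noteq> w \<longrightarrow> \<not> adj u w) \<Longrightarrow> card S \<le> 2"
    and "\<not> colorable adj V k"
  shows "clique_immersion adj V (Suc k)"
  using assms(2-)
proof (induction "card V" arbitrary: V k rule: less_induct)
  case less
  note fin = less.prems(1) and h = less.prems(2) and hom = less.prems(3) and indep = less.prems(4)
    and ncol = less.prems(5)
  have IH: "clique_immersion adj U (Suc j)" if "U \<subset> V" "\<not> colorable adj U j" for U j
  proof (rule less.hyps)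
    show "card U < card V" using that(1) fin by (rule psubset_card_mono[rotated])
    show "finite U" using that(1) fin by (meson finite_subset psubset_imp_subset)
    show "card S \<le> 2" if "S \<subseteq> U" "\<forall>u \<in> S. \<forall>w \<in> S. u \<noteq> w \<longrightarrow> \<not> adj u w" for S
      using indep[of S] that \<open>U \<subset> V\<close> by blast
  qed (use h hom that in auto)
  show ?case
  proof (cases "\<exists>v \<in> V. \<not> colorable adj (V - {v}) k")
    case True
    then obtain v where "v \<in> V" "\<not> colorable adj (V - {v}) k" by blast
    then have "clique_immersion adj (V - {v}) (Suc k)" by (intro IH) auto
    then show ?thesis by (rule clique_immersion_mono) auto
  next
    case crit: False
    show ?thesis
    \<comment> \<open>Such a \<open>U\<close> has no non-edge leaving it, so it is a union of
      components of the complement. If there is none, the connectedness required by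
      \<open>gallai\<close> holds.\<close>
    proof (cases "\<exists>U. U \<subseteq> V \<and> U \<noteq> {} \<and> U \<noteq> V \<and> (\<forall>u \<in> U. \<forall>w \<in> V - U. adj u w)")
      case True
      then obtain U where U: "U \<subseteq> V" "U \<noteq> {}" "U \<noteq> V" "\<forall>u \<in> U. \<forall>w \<in> V - U. adj u w"
        by blast
      \<comment> \<open>Here \<open>l\<close> is the chromatic number of the part. The value 0 is
        separate because the induction hypothesis only yields cliques of size
        \<open>Suc j\<close>.\<close>
      have part: "\<exists>l. colorable adj W l \<and> clique_immersion adj W l" if "W \<subset> V" for W
      proof -
        have "colorable adj W (card W - card ({} :: 'a set set))"
          using that fin sym by (intro colorable_diff_matching) (auto simp: matching_def intro: finite_subset)
        then have col: "colorable adj W (LEAST l. colorable adj W l)" by (rule LeastI)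
        have "clique_immersion adj W (LEAST l. colorable adj W l)"
        proof (cases "LEAST l. colorable adj W l")
          case 0
          then show ?thesis using clique_immersion_clique[of "{}" W 0] by simp
        next
          case (Suc j)
          then have "\<not> colorable adj W j" by (metis lessI not_less_Least)
          then show ?thesis using IH[OF that] Suc by simp
        qed
        then show ?thesis using col by blast
      qed
      obtain l where l: "colorable adj U l" "clique_immersion adj U l" using part[of U] U by blast
      obtain l' where l': "colorable adj (V - U) l'" "clique_immersion adj (V - U) l'"
        using part[of "V - U"] U by blast
      have V: "U \<union> (V - U) = V" using U(1) by blast
      have "colorable adj V (l + l')" using colorable_join[OF l(1) l'(1)] V by simp
      then have "Suc k \<le> l + l'" using ncol colorable_mono by (metis not_less_eq_eq)
      moreover have "clique_immersion adj V (l + l')"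
        using clique_immersion_join[OF l(2) l'(2)] U fin V by (auto intro: finite_subset)
      ultimately show ?thesis using clique_immersion_mono by blast
    next
      case conn: False
      \<comment> \<open>This is the maximum size of a matching in the complement: a larger one would
        give a \<open>k\<close>-colouring of \<open>V\<close>, and a \<open>k\<close>-colouring of
        \<open>V - {v}\<close> gives one of this size that misses \<open>v\<close>.\<close>
      define K where "K = card V - Suc k"
      have M_le: "card M < card V - k" if "matching (\<lambda>u w. \<not> adj u w) V M" for M
        using colorable_diff_matching[OF fin that sym] ncol colorable_mono[of adj V "card V - card M" k]
        by (cases "card V - card M \<le> k") auto
      have "card V = 2 * K + 1"
      proof (rule gallai[where R = "\<lambda>u w. \<not> adj u w"])
        show "V \<noteq> {}" using ncol by (auto simp: colorable_def)
        show "card M \<le> K" if "matching (\<lambda>u w. \<not> adj u w) V M" for M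
          using M_le[OF that] by (simp add: K_def)
        show "\<exists>M. matching (\<lambda>u w. \<not> adj u w) (V - {v}) M \<and> card M = K" if v: "v \<in> V" for v
        proof -
          have "\<exists>M. matching (\<lambda>u w. \<not> adj u w) (V - {v}) M \<and> card (V - {v}) \<le> k + card M"
          proof (rule colorable_imp_matching)
            show "card S \<le> 2" if "S \<subseteq> V - {v}" "\<forall>u \<in> S. \<forall>w \<in> S. u \<noteq> w \<longrightarrow> \<not> adj u w" for S
              using indep[of S] that by blast
          qed (use fin crit v in auto)
          then obtain M where M: "matching (\<lambda>u w. \<not> adj u w) (V - {v}) M" "card (V - {v}) \<le> k + card M"
            by blast
          have "card M < card V - k" using M_le matching_mono[OF M(1)] by blast
          then have "card M = K" using M(2) fin v by (simp add: K_def card_Diff_singleton)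
          then show ?thesis using M(1) by blast
        qed
        show "\<exists>u \<in> U. \<exists>w \<in> V - U. \<not> adj u w" if "U \<subseteq> V" "U \<noteq> {}" "U \<noteq> V" for U
          using conn that by blast
      qed (use fin in auto)
      \<comment> \<open>This rules out that the subtraction in \<open>K\<close> was truncated, so
        that \<open>card V = 2 * K + 1\<close> can be solved for \<open>card V\<close>.\<close>
      moreover have "0 < card V - k" using M_le[of "{}"] by (simp add: matching_def)
      ultimately have "card V = 2 * Suc k - 1" by (simp add: K_def)
      then show ?thesis
        using andrasfai_clique_immersion[OF fin _ _ h hom sym, of "Suc k"] by simp
    qed
  qed
qed

section \<open>Transfer to immersions as minimal subgraphs\<close>

lemma edges_complete_graph: "edges (complete_graph k) = doubletons {..<k}"
  by (auto simp: edges_def complete_graph_def doubletons_def)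

text \<open>The union of the branch vertices and the paths is the required subgraph. It is minimal
  because any symmetric subgraph that carries the same paths contains their vertices and both
  orientations of their edges.\<close>

lemma contains_strong_immersion_complete_graph:
  assumes G: "pair_graph G" and imm: "clique_immersion (\<lambda>u v. (u, v) \<in> parcs G) (pverts G) k"
  shows "contains_strong_immersion G (complete_graph k)"
proof -
  interpret G: pair_graph G by (rule G)
  have G_sym: "(v, u) \<in> parcs G" if "(u, v) \<in> parcs G" for u v
    using G.pair_sym_arcs that by (auto simp: symmetric_def dest: symD)
  obtain B Q where B: "B \<subseteq> pverts G" "card B = k"
    and Q: "\<And>e. e \<in> doubletons B \<Longrightarrow> strong_path (\<lambda>u v. (u, v) \<in> parcs G) (pverts G) B e (Q e)"
    and disj: "\<And>e f. e \<in> doubletons B \<Longrightarrow> f \<in> doubletons B \<Longrightarrow> e \<noteq> f \<Longrightarrow>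
                 path_edges (Q e) \<inter> path_edges (Q f) = {}"
    by (rule clique_immersionE[OF imm]) (rule that)
  have "finite B" using B(1) G.pair_finite_verts by (rule finite_subset)
  then obtain i where i: "bij_betw i {..<k} B"
    using ex_bij_betw_nat_finite B(2) by (metis atLeast0LessThan)
  then have inj: "inj_on i {..<k}" and img: "i ` {..<k} = B"
    by (auto simp: bij_betw_def)
  have dbl: "(`) i ` doubletons {..<k} = doubletons B"
  proof
    show "(`) i ` doubletons {..<k} \<subseteq> doubletons B"
      using inj img by (auto simp: doubletons_def dest: inj_onD)
    show "doubletons B \<subseteq> (`) i ` doubletons {..<k}"
    proof
      fix e assume "e \<in> doubletons B"
      then obtain a b where "a \<in> {..<k}" "b \<in> {..<k}" "e = {i a, i b}" "i a \<noteq> i b"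
        unfolding doubletons_def img[symmetric] by blast
      then have "{a, b} \<in> doubletons {..<k}" "e = i ` {a, b}" by (auto simp: doubletons_def)
      then show "e \<in> (`) i ` doubletons {..<k}" by blast
    qed
  qed
  then have ie: "i ` e \<in> doubletons B" if "e \<in> doubletons {..<k}" for e using that by blast
  have ineq: "i ` e \<noteq> i ` f" if "e \<in> doubletons {..<k}" "f \<in> doubletons {..<k}" "e \<noteq> f" for e f
    using inj_on_image_eq_iff[OF inj, of e f] that by (auto simp: doubletons_def)
  define P where "P e = Q (i ` e)" for e
  \<comment> \<open>\<open>B\<close> is listed separately for the case \<open>k = 1\<close>, where
    there are no paths to contain the branch vertex.\<close>
  define I where "I = \<lparr>pverts = B \<union> (\<Union>e \<in> doubletons B. set (Q e)),
    parcs = {(u, v). \<exists>e \<in> doubletons B. {u, v} \<in> path_edges (Q e)}\<rparr>"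
  have arcs_I: "(u, v) \<in> parcs I \<longleftrightarrow>
      (\<exists>e \<in> doubletons B. (u, v) \<in> set (vwalk_arcs (Q e)) \<or> (v, u) \<in> set (vwalk_arcs (Q e)))" for u v
    unfolding I_def path_edges_def by (auto simp: doubleton_eq_iff)
  have arcs_IG: "parcs I \<subseteq> parcs G"
    using Q G_sym unfolding strong_path_def by (fastforce simp: arcs_I)
  have verts_IG: "pverts I \<subseteq> pverts G"
  proof -
    have "set (Q e) \<subseteq> pverts G" if "e \<in> doubletons B" for e
      using Q[OF that] by (simp add: strong_path_def)
    then show ?thesis using B(1) by (auto simp: I_def)
  qed
  have ends_I: "u \<in> pverts I \<and> v \<in> pverts I" if uv: "(u, v) \<in> parcs I" for u v
  proof -
    obtain e where "e \<in> doubletons B" "{u, v} \<in> path_edges (Q e)" using uv by (auto simp: I_def)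
    then show ?thesis using path_edges_subset[of "{u, v}" "Q e"] by (auto simp: I_def)
  qed
  have sym_I: "(v, u) \<in> parcs I" if "(u, v) \<in> parcs I" for u v
    using that by (auto simp: I_def insert_commute)
  have I: "pair_graph I"
  proof unfold_locales
    show "fst a \<in> pverts I" "snd a \<in> pverts I" if "a \<in> parcs I" for a
      using ends_I[of "fst a" "snd a"] that by simp_all
    show "finite (pverts I)" using verts_IG G.pair_finite_verts by (rule finite_subset)
    show "finite (parcs I)" using arcs_IG G.pair_finite_arcs by (rule finite_subset)
    show "fst a \<noteq> snd a" if "a \<in> parcs I" for a using that arcs_IG G.pair_no_loops by blast
    show "symmetric (with_proj I)" using sym_I by (auto simp: symmetric_def intro: symI)
  qed
  then interpret I: pair_graph I .
  have sub_IG: "subgraph (with_proj I) (with_proj G)"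
    using verts_IG arcs_IG G.wf_digraph_axioms I.wf_digraph_axioms
    by (auto simp: subgraph_def compatible_def)
  have paths_I: "immersion_paths (complete_graph k) I i P"
    unfolding immersion_paths_def edges_complete_graph
  proof (intro conjI ballI impI)
    show "i ` pverts (complete_graph k) \<subseteq> pverts I" "inj_on i (pverts (complete_graph k))"
      using inj img by (auto simp: complete_graph_def I_def)
    fix e assume e: "e \<in> doubletons {..<k}"
    have "strong_path (\<lambda>u v. (u, v) \<in> parcs G) (pverts G) B (i ` e) (P e)"
      using Q[OF ie[OF e]] by (simp add: P_def)
    moreover have "set (vwalk_arcs (P e)) \<subseteq> parcs I" "set (P e) \<subseteq> pverts I"
      using ie[OF e] arcs_I by (auto simp: P_def I_def)
    ultimately show "vpath (P e) (with_proj I)" "{hd (P e), last (P e)} = i ` e"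
      by (auto simp: strong_path_def vpath_def vwalk_def)
    fix f assume "f \<in> doubletons {..<k}" "e \<noteq> f"
    then show "path_edges (P e) \<inter> path_edges (P f) = {}"
      using disj[OF ie[OF e] ie[of f]] ineq[OF e, of f] by (simp add: P_def)
  qed
  have "J = I" if J: "pair_graph J" "subgraph (with_proj J) (with_proj I)"
    "immersion_paths (complete_graph k) J i P" for J
  proof -
    interpret J: pair_graph J by (rule J(1))
    have J_sym: "(v, u) \<in> parcs J" if "(u, v) \<in> parcs J" for u v
      using J.pair_sym_arcs that by (auto simp: symmetric_def dest: symD)
    have JI: "pverts J \<subseteq> pverts I" "parcs J \<subseteq> parcs I"
      using J(2) by (auto simp: subgraph_def)
    have BJ: "B \<subseteq> pverts J"
      using J(3) img by (auto simp: immersion_paths_def complete_graph_def)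
    have QJ: "set (Q e) \<subseteq> pverts J \<and> set (vwalk_arcs (Q e)) \<subseteq> parcs J" if "e \<in> doubletons B" for e
    proof -
      have "e \<in> (`) i ` doubletons {..<k}" using that dbl by simp
      then obtain f where f: "f \<in> doubletons {..<k}" "e = i ` f" by (rule imageE)
      have "\<forall>f \<in> doubletons {..<k}. vpath (P f) (with_proj J)"
        using J(3) by (simp add: immersion_paths_def edges_complete_graph)
      then have "vpath (Q e) (with_proj J)" using f by (simp add: P_def)
      then show ?thesis by (simp add: vpath_def vwalk_def)
    qed
    have "pverts I \<subseteq> pverts J" using BJ QJ by (auto simp: I_def)
    moreover have "parcs I \<subseteq> parcs J" using QJ J_sym arcs_I by fast
    ultimately show ?thesis using JI by (intro pair_pre_digraph.equality) auto
  qed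
  then have "immersion (complete_graph k) G I i P"
    unfolding immersion_def using I sub_IG paths_I by blast
  moreover have "set (butlast (tl (P e))) \<inter> i ` pverts (complete_graph k) = {}"
    if "e \<in> edges (complete_graph k)" for e
  proof -
    have "pverts (complete_graph k) = {..<k}" by (simp add: complete_graph_def)
    then show ?thesis
      using Q[OF ie, of e] that img by (simp add: edges_complete_graph strong_path_def P_def)
  qed
  ultimately show ?thesis
    unfolding contains_strong_immersion_def strong_immersion_def by blast
qed

theorem theorem15:
  fixes G :: "'a pair_pre_digraph"
  assumes "pair_graph G"
    and "independence_number G \<le> 2"
    and "\<exists>d. homomorphic_to (graph_complement G) (andrasfai_graph d)"
  shows "contains_strong_immersion G (complete_graph (chromatic_number G))"
proof -
  interpret G: pair_graph G by (rule assms(1))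
  define adj where "adj = (\<lambda>u v. (u, v) \<in> parcs G)"
  obtain d h where h: "graph_hom h (graph_complement G) (andrasfai_graph d)"
    using assms(3) by (auto simp: homomorphic_to_def)
  have sym: "adj v u" if "adj u v" for u v
    using G.pair_sym_arcs that by (auto simp: adj_def symmetric_def dest: symD)
  have irrefl: "\<not> adj u u" for u
    using G.pair_no_loops[of "(u, u)"] by (auto simp: adj_def)
  have indep: "card S \<le> 2"
    if "S \<subseteq> pverts G" "\<forall>u \<in> S. \<forall>w \<in> S. u \<noteq> w \<longrightarrow> \<not> adj u w" for S
  proof -
    \<comment> \<open>\<open>independent_set\<close> also compares a vertex with itself, so the
      absence of loops is used here.\<close>
    have "independent_set G S"
      using that irrefl unfolding independent_set_def adj_def by metis
    moreover have "finite {S. independent_set G S}"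
      by (rule finite_subset[of _ "Pow (pverts G)"])
        (auto simp: independent_set_def)
    ultimately have "card S \<le> independence_number G"
      unfolding independence_number_def by (intro Max_ge) auto
    then show ?thesis using assms(2) by simp
  qed
  have proper: "colorable adj (pverts G) k \<longleftrightarrow> (\<exists>c. proper_coloring G k c)" for k
  proof -
    have "(\<forall>u \<in> pverts G. \<forall>w \<in> pverts G. u \<noteq> w \<longrightarrow> adj u w \<longrightarrow> c u \<noteq> c w) \<longleftrightarrow>
          (\<forall>(u, w) \<in> parcs G. c u \<noteq> c w)" for c :: "'a \<Rightarrow> nat"
      using irrefl G.in_arcsD1 G.in_arcsD2 by (fastforce simp: adj_def)
    then show ?thesis by (simp add: colorable_def proper_coloring_def)
  qed
  have "clique_immersion adj (pverts G) (chromatic_number G)"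
  proof (cases "chromatic_number G")
    case 0
    then show ?thesis using clique_immersion_clique[of "{}" "pverts G" 0] by simp
  next
    case (Suc k)
    then have "\<not> colorable adj (pverts G) k"
      unfolding proper chromatic_number_def by (metis lessI not_less_Least)
    then show ?thesis
      unfolding Suc
    proof (rule not_colorable_imp_clique_immersion[rotated 5])
      show "h u \<in> {1..3 * d - 1}" if "u \<in> pverts G" for u
        using h that by (auto simp: graph_hom_def graph_complement_def andrasfai_graph_def)
      show "(h u, h w) \<in> parcs (andrasfai_graph d)"
        if "u \<in> pverts G" "w \<in> pverts G" "u \<noteq> w" "\<not> adj u w" for u w
        using h that by (auto simp: graph_hom_def graph_complement_def adj_def)
    qed (use sym indep G.pair_finite_verts in auto)
  qed
  then show ?thesis
    unfolding adj_def by (rule contains_strong_immersion_complete_graph[OF assms(1)])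
qed

end
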